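(* Let $d\ge1$ be an integer and $\alpha\in(0,2)$ with $d>4-2\alpha$ and $d>\alpha$. Let $\{w_{x,y}:x,y\in\mathbb{Z}^d\}$ be a family of independent random variables (indexed by unordered pairs) on a probability space $(\Omega,\mathcal{F}_\Omega,\mathbb{P})$ such that $w_{x,y}=w_{y,x}\ge0$ for $x\ne y$, $w_{x,x}=0$, $\sup_{x\ne y}\mathbb{P}(w_{x,y}=0)<2^{-4}$, and $$\sup_{x\ne y}\mathbb{E}[w_{x,y}^{2p}]<\infty,\qquad\sup_{x\ne y}\mathbb{E}[w_{x,y}^{-2q}\mathbf{1}_{\{w_{x,y}\ne0\}}]<\infty$$ for some $p,q\in\mathbb{Z}_+$ with $p>\max\{\frac{d+1+\theta_0}{d\theta_0},\frac{d+1}{2\theta_0(2-\alpha)}\}$ and $q>\frac{d+1+\theta_0}{d\theta_0}$, where $\theta_0=\alpha/(2d+\alpha)$. Assume further that $$\sup_{x,y\in\mathbb{Z}^d:x\ne y}w_{x,y}^{-1}<\infty\quad\mathbb{P}\text{-a.s.},$$ $$\inf_{x,y\in\mathbb{Z}^d:x\ne y}\mathbb{P}(w_{x,y}\le c_0)>0\ \text{ for some }c_0>0,\qquad \inf_{x,y\in\mathbb{Z}^d:x\ne y}\mathbb{P}(w_{x,y}>k)>0\ \text{ for any }k>0.$$ Then for $\mathbb{P}$-a.s. $\omega\in\Omega$, the elliptic Harnack inequality (EHI) associated with the generator $\mathcal{L}^\omega$ of the variable speed random walk does not hold at any $x_0\in\mathbb{Z}^d$.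
   Context: The variable speed random walk is the symmetric Hunt process on $\mathbb{Z}^d$ (with counting measure as reference measure) with generator $\mathcal{L}^\omega f(x)=\sum_{y\in\mathbb{Z}^d}(f(y)-f(x))\frac{w_{x,y}(\omega)}{|x-y|^{d+\alpha}}$. A function $u$ is harmonic with respect to $\mathcal{L}^\omega$ on $A\subset\mathbb{Z}^d$ if $\mathcal{L}^\omega u(x)=0$ for every $x\in A$. $B(x,r)$ denotes the closed ball of radius $r$ centred at $x$. EHI holds at $x_0$ if there are constants $R_0=R_0(x_0)\ge1$ and $c_1=c_1(x_0,R_0)\ge1$ such that for every $R\ge R_0$ and every non-negative function $f$ on $\mathbb{Z}^d$ which is harmonic on $B(x_0,2R)$, $\sup_{x\in B(x_0,R)}f(x)\le c_1\inf_{x\in B(x_0,R)}f(x)$. *)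

theory Defs
  imports "HOL-Probability.Probability" "HOL-Library.Uprod"
begin

text \<open>The lattice \<open>\<int>\<^sup>d\<close> is \<^typ>\<open>int^'n\<close> with \<open>d = CARD('n)\<close>; it carries the Euclidean distance
  of its image in \<^typ>\<open>real^'n\<close>.\<close>

definition lattice_vec :: "int^'n \<Rightarrow> real^'n" where
  "lattice_vec x = (\<chi> i. real_of_int (x $ i))"

definition lattice_dist :: "int^'n \<Rightarrow> int^'n \<Rightarrow> real" where
  "lattice_dist x y = norm (lattice_vec x - lattice_vec y)"

definition lattice_ball :: "int^'n \<Rightarrow> real \<Rightarrow> (int^'n) set" where
  "lattice_ball x r = {y. lattice_dist x y \<le> r}"

text \<open>Weights are indexed by unordered pairs, so \<open>c (Upair x y)\<close> is \<open>w\<^bsub>x,y\<^esub>(\<omega>)\<close> for a frozen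
  environment \<open>\<omega>\<close>. In the next two definitions the diagonal term \<open>y = x\<close> vanishes because of the
  factor \<open>f y - f x\<close>.\<close>

definition vsrw_term ::
  "real \<Rightarrow> ((int^'n) uprod \<Rightarrow> real) \<Rightarrow> (int^'n \<Rightarrow> real) \<Rightarrow> int^'n \<Rightarrow> int^'n \<Rightarrow> real" where
  "vsrw_term \<alpha> c f x y =
     (f y - f x) * (c (Upair x y) / lattice_dist x y powr (real CARD('n) + \<alpha>))"

definition vsrw_generator ::
  "real \<Rightarrow> ((int^'n) uprod \<Rightarrow> real) \<Rightarrow> (int^'n \<Rightarrow> real) \<Rightarrow> int^'n \<Rightarrow> real" where
  "vsrw_generator \<alpha> c f x = (\<Sum>\<^sub>\<infinity>y. vsrw_term \<alpha> c f x y)"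

text \<open>Summability is required explicitly, because \<^const>\<open>infsum\<close> returns \<open>0\<close> on families that are
  not summable.\<close>

definition vsrw_harmonic_on ::
  "real \<Rightarrow> ((int^'n) uprod \<Rightarrow> real) \<Rightarrow> (int^'n \<Rightarrow> real) \<Rightarrow> (int^'n) set \<Rightarrow> bool" where
  "vsrw_harmonic_on \<alpha> c u A \<longleftrightarrow>
     (\<forall>x\<in>A. vsrw_term \<alpha> c u x summable_on UNIV \<and> vsrw_generator \<alpha> c u x = 0)"

definition EHI :: "real \<Rightarrow> ((int^'n) uprod \<Rightarrow> real) \<Rightarrow> int^'n \<Rightarrow> bool" where
  "EHI \<alpha> c x0 \<longleftrightarrow>
     (\<exists>R0\<ge>1. \<exists>c1\<ge>1. \<forall>R\<ge>R0. \<forall>f.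
        (\<forall>x. f x \<ge> 0) \<longrightarrow> vsrw_harmonic_on \<alpha> c f (lattice_ball x0 (2 * R)) \<longrightarrow>
        (SUP x\<in>lattice_ball x0 R. f x) \<le> c1 * (INF x\<in>lattice_ball x0 R. f x))"

end

theory Submission
  imports Defs
begin

text \<open>Write \<open>a(x,y) = w\<^bsub>x,y\<^esub> / \<bar>x - y\<bar>\<^bsup>d+\<alpha>\<^esup>\<close>, \<open>B = B(x\<^sub>0,2R)\<close>, and let \<open>h\<close> be
  the function harmonic on \<open>B\<close> with exterior values \<open>1\<close> at a single point \<open>z\<close> and \<open>0\<close> elsewhere.
  By independence, almost surely some far away \<open>z\<close> has \<open>w\<^bsub>x\<^sub>0,z\<^esub>\<close> so large and all the other
  \<open>w\<^bsub>x,z\<^esub>\<close>, \<open>x \<in> B\<close>, so small that \<open>a(x\<^sub>0,z)\<close> dominates the sum of the others. Summing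
  \<open>\<L>h = 0\<close> over \<open>B\<close> shows that the outgoing flow \<open>\<Sum>\<^bsub>x\<in>B\<^esub> h(x) a(x,B\<^sup>c)\<close> is at most
  \<open>\<Sum>\<^bsub>x\<in>B\<^esub> a(x,z) \<le> 2 a(x\<^sub>0,z)\<close>, while harmonicity at \<open>x\<^sub>0\<close> gives
  \<open>a(x\<^sub>0,z) \<le> h(x\<^sub>0) \<Sum>\<^sub>y a(x\<^sub>0,y)\<close>. Under the Harnack inequality \<open>h \<ge> h(x\<^sub>0)/c\<^sub>1\<close> on
  \<open>B(x\<^sub>0,R)\<close>, and as \<open>w\<close> is bounded below the outgoing flow is at least of order
  \<open>h(x\<^sub>0) R\<^bsup>d-\<alpha>\<^esup>\<close>. Since \<open>d > \<alpha>\<close>, this is absurd for large \<open>R\<close>.\<close>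

subsection \<open>The lattice\<close>

lemma lattice_dist_nonneg [simp]: "0 \<le> lattice_dist x y"
  by (simp add: lattice_dist_def)

lemma lattice_dist_self [simp]: "lattice_dist x x = 0"
  by (simp add: lattice_dist_def)

lemma lattice_dist_commute: "lattice_dist x y = lattice_dist y x"
  by (simp add: lattice_dist_def norm_minus_commute)

lemma lattice_dist_triangle: "lattice_dist x z \<le> lattice_dist x y + lattice_dist y z"
  unfolding lattice_dist_def by (metis dist_norm dist_triangle)

lemma component_le_lattice_dist: "real_of_int \<bar>x $ i - y $ i\<bar> \<le> lattice_dist x y"
  using component_le_norm_cart[of "lattice_vec x - lattice_vec y" i]
  by (simp add: lattice_dist_def lattice_vec_def)

lemma lattice_dist_le_sum: "lattice_dist x y \<le> (\<Sum>i\<in>UNIV. real_of_int \<bar>x $ i - y $ i\<bar>)"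
  using norm_le_l1_cart[of "lattice_vec x - lattice_vec y"]
  by (simp add: lattice_dist_def lattice_vec_def)

lemma one_le_lattice_dist:
  assumes "x \<noteq> y"
  shows "1 \<le> lattice_dist x y"
proof -
  obtain i where "x $ i \<noteq> y $ i"
    using assms by (auto simp: vec_eq_iff)
  then have "1 \<le> real_of_int \<bar>x $ i - y $ i\<bar>"
    by linarith
  then show ?thesis
    using component_le_lattice_dist[of x i y] by linarith
qed

text \<open>Transfers cardinality, finiteness and summability over dependent products
  \<open>PiE\<close> to sets of vectors given by coordinatewise constraints.\<close>

lemma bij_betw_vec_lambda_PiE:
  "bij_betw vec_lambda (PiE UNIV S) {x :: 'a^'n. \<forall>i. x $ i \<in> S i}"
  by (rule bij_betw_byWitness[where f' = vec_nth])
     (auto simp: vec_lambda_inverse PiE_iff)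

lemma card_vec_box: "card {x :: 'a^'n. \<forall>i. x $ i \<in> S i} = (\<Prod>i\<in>UNIV. card (S i))"
  using bij_betw_same_card[OF bij_betw_vec_lambda_PiE[of S]] by (simp add: card_PiE)

lemma finite_vec_box:
  assumes "\<And>i. finite (S i)"
  shows "finite {x :: 'a^'n. \<forall>i. x $ i \<in> S i}"
  using bij_betw_finite[OF bij_betw_vec_lambda_PiE[of S]] assms by (simp add: finite_PiE)

lemma finite_lattice_ball: "finite (lattice_ball x r)"
proof (rule finite_subset)
  show "lattice_ball x r \<subseteq> {y. \<forall>i. y $ i \<in> {x $ i - \<lceil>r\<rceil> .. x $ i + \<lceil>r\<rceil>}}"
  proof safe
    fix y i assume "y \<in> lattice_ball x r"
    then have "real_of_int \<bar>x $ i - y $ i\<bar> \<le> r"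
      using component_le_lattice_dist[of x i y] by (auto simp: lattice_ball_def)
    then have "\<bar>x $ i - y $ i\<bar> \<le> \<lceil>r\<rceil>"
      by linarith
    then show "y $ i \<in> {x $ i - \<lceil>r\<rceil> .. x $ i + \<lceil>r\<rceil>}"
      by auto
  qed
  show "finite {y. \<forall>i. y $ i \<in> {x $ i - \<lceil>r\<rceil> .. x $ i + \<lceil>r\<rceil>}}"
    by (rule finite_vec_box) simp
qed

lemma infinite_Compl_lattice_ball: "infinite (- lattice_ball (x :: int^'n) r)"
proof
  assume "finite (- lattice_ball x r)"
  then have "finite (UNIV :: (int^'n) set)"
    using finite_lattice_ball[of x r] by (metis Compl_partition finite_UnI)
  moreover have "inj (vec :: int \<Rightarrow> int^'n)"
    by (auto simp: inj_def vec_eq_iff)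
  ultimately show False
    using finite_imageD[of "vec :: int \<Rightarrow> int^'n" UNIV] infinite_UNIV_int
    by (meson finite_subset subset_UNIV)
qed

text \<open>The maximum with 1 removes the singularity at 0. The integers are covered by two copies
  of the naturals, overlapping at 0, and on each copy the family is a p-series up to its first
  term.\<close>

lemma summable_on_int_max_powr:
  assumes "t > 1"
  shows "(\<lambda>k::int. max 1 \<bar>real_of_int k\<bar> powr - t) summable_on UNIV"
proof -
  have nat: "(\<lambda>k::nat. max 1 (real k) powr - t) summable_on UNIV"
  proof (rule norm_summable_imp_summable_on)
    have "summable (\<lambda>k. real (Suc k) powr - t)"
      using assms summable_Suc_iff[of "\<lambda>k. real k powr - t"] summable_real_powr_iff by simp
    then have "summable (\<lambda>k. max 1 (real (Suc k)) powr - t)"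
      by (simp add: max_def)
    then show "summable (\<lambda>k. norm (max 1 (real k) powr - t))"
      by (subst summable_Suc_iff[symmetric]) simp
  qed
  have pos: "(\<lambda>k::int. max 1 \<bar>real_of_int k\<bar> powr - t) summable_on range int"
    using nat by (subst summable_on_reindex) (auto simp: o_def)
  have neg: "(\<lambda>k::int. max 1 \<bar>real_of_int k\<bar> powr - t) summable_on range (\<lambda>n. - int n)"
    using nat by (subst summable_on_reindex) (auto simp: o_def inj_def)
  have "UNIV = range int \<union> range (\<lambda>n. - int n)"
    by (auto simp: image_iff) (metis int_cases2)
  then show ?thesis
    using summable_on_union[OF pos neg] by simp
qed

text \<open>For \<open>v \<noteq> 0\<close> one has \<open>\<bar>v\<bar> \<ge> max 1 \<bar>v\<^sub>i\<bar>\<close> for every \<open>i\<close>, so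
  \<open>\<bar>v\<bar>\<^sup>-\<^sup>s\<close> is dominated by a product of one-dimensional summable functions.\<close>

lemma summable_on_lattice_dist_powr:
  fixes x :: "int^'n"
  assumes "s > real CARD('n)"
  shows "(\<lambda>y. 1 / lattice_dist x y powr s) summable_on UNIV"
proof -
  \<comment> \<open>With this exponent a product of \<open>CARD('n)\<close> equal factors has
    exponent \<open>s\<close>, and \<open>s > CARD('n)\<close> becomes \<open>t > 1\<close>, the
    one-dimensional summability condition.\<close>
  define t where "t = s / real CARD('n)"
  have t: "t > 1"
    using assms by (simp add: t_def)
  define g where "g i k = max 1 \<bar>real_of_int (x $ i - k)\<bar> powr - t" for i and k :: int
  have g_summable: "g i summable_on UNIV" for i
  proof -
    have bij: "bij_betw (\<lambda>k. x $ i - k) UNIV UNIV"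
      by (rule bij_betw_byWitness[where f' = "\<lambda>k. x $ i - k"]) auto
    show ?thesis
      using summable_on_reindex_bij_betw[OF bij, of "\<lambda>k. max 1 \<bar>real_of_int k\<bar> powr - t"]
        summable_on_int_max_powr[OF t]
      unfolding g_def by simp
  qed
  have "Infinite_Set_Sum.abs_summable_on (\<lambda>h. \<Prod>i\<in>UNIV. g i (h i)) (PiE UNIV (\<lambda>_. UNIV))"
  proof (intro abs_summable_on_prod_PiE)
    show "Infinite_Set_Sum.abs_summable_on (g i) UNIV" for i
      using g_summable[of i]
      by (simp only: abs_summable_equivalent[symmetric] summable_on_iff_abs_summable_on_real[symmetric])
  qed auto
  then have "(\<lambda>h. \<Prod>i\<in>UNIV. g i (h i)) summable_on (PiE UNIV (\<lambda>_. UNIV))"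
    by (simp only: abs_summable_equivalent[symmetric] abs_summable_summable)
  then have "(\<lambda>y. \<Prod>i\<in>UNIV. g i (y $ i)) summable_on (UNIV :: (int^'n) set)"
    using summable_on_reindex_bij_betw[OF bij_betw_vec_lambda_PiE[of "\<lambda>_. UNIV"],
        of "\<lambda>y. \<Prod>i\<in>UNIV. g i (y $ i)"] by simp
  then show ?thesis
  proof (rule summable_on_comparison_test)
    fix y
    show "1 / lattice_dist x y powr s \<le> (\<Prod>i\<in>UNIV. g i (y $ i))"
    proof (cases "x = y")
      \<comment> \<open>On the diagonal the left-hand side is \<open>1 / 0 = 0\<close>.\<close>
      case True
      then show ?thesis by (simp add: g_def prod_nonneg)
    next
      case False
      then have d1: "1 \<le> lattice_dist x y"
        by (rule one_le_lattice_dist)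
      have "lattice_dist x y powr - t \<le> g i (y $ i)" for i
        unfolding g_def using d1 t component_le_lattice_dist[of x i y]
        by (intro powr_mono2') auto
      then have "(\<Prod>i\<in>(UNIV::'n set). lattice_dist x y powr - t) \<le> (\<Prod>i\<in>UNIV. g i (y $ i))"
        by (intro prod_mono) auto
      moreover have "(\<Prod>i\<in>(UNIV::'n set). lattice_dist x y powr - t) = lattice_dist x y powr - s"
        using d1 by (simp add: powr_realpow[symmetric] powr_powr t_def)
      ultimately show ?thesis
        by (simp add: powr_minus divide_inverse)
    qed
  qed auto
qed

subsection \<open>Poisson kernels of finite sets\<close>

text \<open>The Picard iterates started at \<open>0\<close> increase to a solution and stay below \<open>1\<close>.\<close>

lemma ex_nonneg_fixed_point:
  fixes a :: "'b \<Rightarrow> 'b \<Rightarrow> real" and b W :: "'b \<Rightarrow> real"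
  assumes "finite B" and a: "\<And>x y. x \<in> B \<Longrightarrow> y \<in> B \<Longrightarrow> 0 \<le> a x y"
    and b: "\<And>x. x \<in> B \<Longrightarrow> 0 \<le> b x" and W: "\<And>x. x \<in> B \<Longrightarrow> 0 < W x"
    and le: "\<And>x. x \<in> B \<Longrightarrow> (\<Sum>y\<in>B. a x y) + b x \<le> W x"
  shows "\<exists>h. \<forall>x\<in>B. 0 \<le> h x \<and> W x * h x = (\<Sum>y\<in>B. a x y * h y) + b x"
proof -
  \<comment> \<open>The equation divided by \<open>W x\<close>, so that solutions are the fixed
    points of a monotone operator.\<close>
  define T where "T h x = ((\<Sum>y\<in>B. a x y * h y) + b x) / W x" for h :: "'b \<Rightarrow> real" and x
  define H where "H n = (T ^^ n) (\<lambda>_. 0)" for n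
  have H_Suc: "H (Suc n) = T (H n)" for n
    by (simp add: H_def)
  have T_mono: "T h x \<le> T h' x" if "\<And>y. y \<in> B \<Longrightarrow> h y \<le> h' y" "x \<in> B" for h h' x
    using that a W unfolding T_def
    by (intro divide_right_mono add_right_mono sum_mono mult_left_mono) (auto simp: less_imp_le)
  have bounds: "0 \<le> H n x \<and> H n x \<le> 1 \<and> H n x \<le> H (Suc n) x" if "x \<in> B" for n x
    using that
  proof (induction n arbitrary: x)
    case 0
    have "0 \<le> T (\<lambda>_. 0) x"
      using b[OF 0] W[OF 0] by (simp add: T_def)
    then show ?case
      by (simp add: H_def)
  next
    case (Suc n)
    \<comment> \<open>By \<open>le\<close> the constant 1 is a supersolution, which keeps all
      iterates below it.\<close>
    have "T (H n) x \<le> T (\<lambda>_. 1) x"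
      using Suc by (intro T_mono) auto
    also have "\<dots> \<le> 1"
      using le[of x] W[of x] Suc.prems by (simp add: T_def)
    finally have "H (Suc n) x \<le> 1"
      by (simp add: H_Suc)
    moreover have "H (Suc n) x \<le> H (Suc (Suc n)) x"
      using Suc by (simp add: H_Suc) (intro T_mono, auto simp: H_Suc)
    moreover have "0 \<le> H (Suc n) x"
      using Suc by (meson order_trans)
    ultimately show ?case
      by blast
  qed
  have "\<exists>l. (\<lambda>n. H n x) \<longlonglongrightarrow> l" if "x \<in> B" for x
  proof -
    have "incseq (\<lambda>n. H n x)"
      using bounds[OF that] by (auto intro: incseq_SucI)
    then show ?thesis
      using incseq_convergent[of "\<lambda>n. H n x" 1] bounds[OF that] by blast
  qed
  then obtain h where h: "\<And>x. x \<in> B \<Longrightarrow> (\<lambda>n. H n x) \<longlonglongrightarrow> h x"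
    by metis
  have "0 \<le> h x \<and> W x * h x = (\<Sum>y\<in>B. a x y * h y) + b x" if x: "x \<in> B" for x
  proof
    show "0 \<le> h x"
      using bounds[OF x] by (intro LIMSEQ_le_const[OF h[OF x]]) auto
    have "(\<lambda>n. H (Suc n) x) \<longlonglongrightarrow> T h x"
      unfolding H_Suc T_def using h W[OF x] by (intro tendsto_intros) auto
    then have "h x = T h x"
      using LIMSEQ_Suc[OF h[OF x]] LIMSEQ_unique by blast
    then show "W x * h x = (\<Sum>y\<in>B. a x y * h y) + b x"
      using W[OF x] by (simp add: T_def field_simps)
  qed
  then show ?thesis
    by blast
qed

text \<open>The kernel is the bounded solution with exterior data \<open>1\<close> at \<open>z\<close> and \<open>0\<close> elsewhere. The last
  conclusion is conservation of flow: summing the generator over \<open>B\<close> cancels all jumps inside \<open>B\<close>.\<close>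

lemma ex_poisson_kernel:
  fixes a :: "'b \<Rightarrow> 'b \<Rightarrow> real"
  assumes B: "finite B" and z: "z \<notin> B"
    and sym: "\<And>x y. a x y = a y x" and nonneg: "\<And>x y. 0 \<le> a x y"
    and summ: "\<And>x. a x summable_on UNIV" and pos: "\<And>x. x \<in> B \<Longrightarrow> 0 < a x z"
  obtains f where "\<And>x. 0 \<le> f x"
    and "\<And>x. x \<in> B \<Longrightarrow> ((\<lambda>y. (f y - f x) * a x y) has_sum 0) UNIV"
    and "\<And>x. x \<in> B \<Longrightarrow> a x z \<le> infsum (a x) UNIV * f x"
    and "\<And>Y. finite Y \<Longrightarrow> Y \<inter> B = {} \<Longrightarrow> (\<Sum>x\<in>B. f x * (\<Sum>y\<in>Y. a x y)) \<le> (\<Sum>x\<in>B. a x z)"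
proof -
  define W where "W x = infsum (a x) UNIV" for x
  have sum_le_W: "sum (a x) F \<le> W x" if "finite F" for x F
    unfolding W_def using that nonneg summ by (intro finite_sum_le_infsum) auto
  have le: "(\<Sum>y\<in>B. a x y) + a x z \<le> W x" for x
    using sum_le_W[of "insert z B" x] B z by simp
  have W_pos: "0 < W x" if "x \<in> B" for x
    using le[of x] pos[OF that] sum_nonneg[of B "a x"] nonneg by fastforce
  obtain h where h: "\<And>x. x \<in> B \<Longrightarrow> 0 \<le> h x"
    and hW: "\<And>x. x \<in> B \<Longrightarrow> W x * h x = (\<Sum>y\<in>B. a x y * h y) + a x z"
    using ex_nonneg_fixed_point[of B a "\<lambda>x. a x z" W] B nonneg W_pos le by blast
  define f where "f x = (if x \<in> B then h x else if x = z then 1 else 0)" for x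
  show thesis
  proof
    show "0 \<le> f x" for x
      using h by (simp add: f_def)
    show "a x z \<le> infsum (a x) UNIV * f x" if "x \<in> B" for x
      using hW[OF that] that h nonneg by (simp add: f_def W_def[symmetric] sum_nonneg)
    show "((\<lambda>y. (f y - f x) * a x y) has_sum 0) UNIV" if x: "x \<in> B" for x
    proof -
      have "((\<lambda>y. f y * a x y) has_sum (\<Sum>y\<in>insert z B. f y * a x y)) (insert z B)"
        using B by (intro has_sum_finite) simp
      \<comment> \<open>\<open>f\<close> vanishes off \<open>insert z B\<close>, so the infinite sum
        is finite; the point \<open>z\<close>, where \<open>f\<close> is 1, supplies the source term
        \<open>a x z\<close>.\<close>
      also have "?this \<longleftrightarrow> ((\<lambda>y. f y * a x y) has_sum (\<Sum>y\<in>insert z B. f y * a x y)) UNIV"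
        by (rule has_sum_cong_neutral) (auto simp: f_def)
      also have "(\<Sum>y\<in>insert z B. f y * a x y) = W x * f x"
        using B z x hW[OF x] by (simp add: f_def mult.commute)
      finally have "((\<lambda>y. f y * a x y) has_sum W x * f x) UNIV" .
      moreover have "((\<lambda>y. - f x * a x y) has_sum - f x * W x) UNIV"
        unfolding W_def by (intro has_sum_cmult_right has_sum_infsum summ)
      ultimately have "((\<lambda>y. f y * a x y + - f x * a x y) has_sum W x * f x + - f x * W x) UNIV"
        by (rule has_sum_add)
      then show ?thesis
        by (simp add: algebra_simps)
    qed
    show "(\<Sum>x\<in>B. f x * (\<Sum>y\<in>Y. a x y)) \<le> (\<Sum>x\<in>B. a x z)" if Y: "finite Y" "Y \<inter> B = {}" for Y
    proof -
      have "(\<Sum>x\<in>B. f x * (\<Sum>y\<in>Y. a x y)) \<le> (\<Sum>x\<in>B. f x * (W x - (\<Sum>y\<in>B. a x y)))"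
      proof (intro sum_mono mult_left_mono)
        fix x assume "x \<in> B"
        then show "0 \<le> f x"
          using h by (simp add: f_def)
        \<comment> \<open>\<open>Y\<close> and \<open>B\<close> are disjoint, so their masses
          together are at most the total mass \<open>W x\<close>.\<close>
        show "(\<Sum>y\<in>Y. a x y) \<le> W x - (\<Sum>y\<in>B. a x y)"
          using sum_le_W[of "Y \<union> B" x] Y B by (simp add: sum.union_disjoint)
      qed
      also have "\<dots> = (\<Sum>x\<in>B. W x * h x) - (\<Sum>x\<in>B. \<Sum>y\<in>B. a x y * h x)"
        by (simp add: f_def algebra_simps sum_subtractf sum_distrib_left)
      also have "(\<Sum>x\<in>B. \<Sum>y\<in>B. a x y * h x) = (\<Sum>x\<in>B. \<Sum>y\<in>B. a x y * h y)"
        by (subst sum.swap) (simp add: sym)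
      also have "(\<Sum>x\<in>B. W x * h x) - \<dots> = (\<Sum>x\<in>B. a x z)"
        by (simp add: hW sum.distrib)
      finally show ?thesis .
    qed
  qed
qed

subsection \<open>Failure of the Harnack inequality for a fixed environment\<close>

text \<open>The pairs in \<open>X\<close> times \<open>Y\<close> number at least
  \<open>n ^ (2 * d)\<close> and have distance at most of order \<open>n\<close>, which makes the
  flow out of the large ball at least of order \<open>n powr (d - \<alpha>)\<close>. The radius
  \<open>d * n\<close> comes from bounding the Euclidean norm by the l1 norm.\<close>

lemma ex_separated_boxes:
  fixes x0 :: "int^'n" and n :: nat
  defines "d \<equiv> CARD('n)"
  obtains X Y where "finite X" "finite Y"
    and "X \<subseteq> lattice_ball x0 (real (d * n))" "Y \<inter> lattice_ball x0 (2 * real (d * n)) = {}"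
    and "n ^ d \<le> card X" "n ^ d \<le> card Y"
    and "\<And>x y. x \<in> X \<Longrightarrow> y \<in> Y \<Longrightarrow> lattice_dist x y \<le> real (3 * d\<^sup>2 * n)"
proof
  define SX where "SX i = {x0 $ i .. x0 $ i + int n}" for i
  \<comment> \<open>The \<open>+ 1\<close> puts each coordinate strictly beyond
    \<open>2 * d * n\<close>, so a single coordinate already shows that the point is outside the
    closed ball; exactly \<open>d * n\<close> integers remain per coordinate.\<close>
  define SY where "SY i = {x0 $ i + 2 * int (d * n) + 1 .. x0 $ i + 3 * int (d * n)}" for i
  define X where "X = {x. \<forall>i. x $ i \<in> SX i}"
  define Y where "Y = {x. \<forall>i. x $ i \<in> SY i}"
  have d: "1 \<le> d"
    by (simp add: d_def Suc_leI)
  then have n_le: "n \<le> d * n"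
    by (cases d) auto
  show "finite X" "finite Y"
    unfolding X_def Y_def by (rule finite_vec_box, simp add: SX_def SY_def)+
  have "n ^ d \<le> (Suc n) ^ d"
    by (rule power_mono) auto
  then show "n ^ d \<le> card X"
    unfolding X_def card_vec_box by (simp add: SX_def d_def nat_add_distrib)
  have "n ^ d \<le> (d * n) ^ d"
    using n_le by (rule power_mono) auto
  moreover have "card (SY i) = d * n" for i
    by (simp add: SY_def nat_mult_distrib)
  ultimately show "n ^ d \<le> card Y"
    unfolding Y_def card_vec_box by (simp add: d_def)
  show "X \<subseteq> lattice_ball x0 (real (d * n))"
  proof
    fix x assume x: "x \<in> X"
    have "lattice_dist x0 x \<le> (\<Sum>i\<in>UNIV. real_of_int \<bar>x0 $ i - x $ i\<bar>)"
      by (rule lattice_dist_le_sum)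
    also have "\<dots> \<le> (\<Sum>i\<in>(UNIV::'n set). real n)"
    proof (rule sum_mono)
      fix i
      have "\<bar>x0 $ i - x $ i\<bar> \<le> int n"
        using x by (auto simp: X_def SX_def dest: spec[of _ i])
      then show "real_of_int \<bar>x0 $ i - x $ i\<bar> \<le> real n"
        by linarith
    qed
    finally show "x \<in> lattice_ball x0 (real (d * n))"
      by (simp add: lattice_ball_def d_def)
  qed
  show "Y \<inter> lattice_ball x0 (2 * real (d * n)) = {}"
  proof safe
    fix y assume "y \<in> Y" "y \<in> lattice_ball x0 (2 * real (d * n))"
    then obtain i where i: "y $ i \<in> SY i" "lattice_dist x0 y \<le> 2 * real (d * n)"
      by (auto simp: Y_def lattice_ball_def)
    then have "2 * int (d * n) + 1 \<le> \<bar>x0 $ i - y $ i\<bar>"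
      by (auto simp: SY_def)
    then have "real_of_int (2 * int (d * n) + 1) \<le> real_of_int \<bar>x0 $ i - y $ i\<bar>"
      by (simp only: of_int_le_iff)
    then show "y \<in> {}"
      using component_le_lattice_dist[of x0 i y] i(2) by simp
  qed
  show "lattice_dist x y \<le> real (3 * d\<^sup>2 * n)" if x: "x \<in> X" and y: "y \<in> Y" for x y
  proof -
    have "lattice_dist x y \<le> (\<Sum>i\<in>UNIV. real_of_int \<bar>x $ i - y $ i\<bar>)"
      by (rule lattice_dist_le_sum)
    also have "\<dots> \<le> (\<Sum>i\<in>(UNIV::'n set). real (3 * d * n))"
    proof (rule sum_mono)
      fix i
      have "x $ i \<in> SX i" "y $ i \<in> SY i"
        using x y by (auto simp: X_def Y_def)
      moreover have "int n \<le> int (d * n)"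
        using n_le by (simp only: of_nat_le_iff)
      ultimately have "\<bar>x $ i - y $ i\<bar> \<le> 3 * int (d * n)"
        unfolding SX_def SY_def atLeastAtMost_iff by linarith
      then have "real_of_int \<bar>x $ i - y $ i\<bar> \<le> real_of_int (3 * int (d * n))"
        by (simp only: of_int_le_iff)
      then show "real_of_int \<bar>x $ i - y $ i\<bar> \<le> real (3 * d * n)"
        by (simp add: mult.assoc)
    qed
    also have "\<dots> = real (3 * d\<^sup>2 * n)"
      by (simp add: d_def power2_eq_square)
    finally show ?thesis .
  qed
qed

text \<open>Pointwise form of the inequality: balls are finite, so the real \<open>SUP\<close> and
  \<open>INF\<close> are over bounded sets and do bound the individual values.\<close>

lemma EHI_D:
  assumes "EHI \<alpha> c x0"
  obtains R0 c1 where "1 \<le> c1"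
    and "\<And>R f x y. R0 \<le> R \<Longrightarrow> (\<And>x. 0 \<le> f x) \<Longrightarrow> vsrw_harmonic_on \<alpha> c f (lattice_ball x0 (2 * R))
      \<Longrightarrow> x \<in> lattice_ball x0 R \<Longrightarrow> y \<in> lattice_ball x0 R \<Longrightarrow> f x \<le> c1 * f y"
proof -
  obtain R0 c1 where c1: "1 \<le> c1"
    and H: "\<And>R f. R0 \<le> R \<Longrightarrow> (\<forall>x. 0 \<le> f x) \<Longrightarrow> vsrw_harmonic_on \<alpha> c f (lattice_ball x0 (2 * R))
      \<Longrightarrow> (SUP x\<in>lattice_ball x0 R. f x) \<le> c1 * (INF x\<in>lattice_ball x0 R. f x)"
    using assms unfolding EHI_def by blast
  show thesis
  proof
    fix R f x y
    assume *: "R0 \<le> R" "\<And>x. 0 \<le> f x" "vsrw_harmonic_on \<alpha> c f (lattice_ball x0 (2 * R))"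
      "x \<in> lattice_ball x0 R" "y \<in> lattice_ball x0 R"
    have "f x \<le> (SUP x\<in>lattice_ball x0 R. f x)"
      using * finite_lattice_ball by (intro cSUP_upper bdd_above_finite) auto
    also have "\<dots> \<le> c1 * (INF x\<in>lattice_ball x0 R. f x)"
      using * by (intro H) auto
    also have "\<dots> \<le> c1 * f y"
      using * c1 finite_lattice_ball by (intro mult_left_mono cINF_lower bdd_below_finite) auto
    finally show "f x \<le> c1 * f y" .
  qed (rule c1)
qed

definition conductance :: "real \<Rightarrow> ((int^'n) uprod \<Rightarrow> real) \<Rightarrow> int^'n \<Rightarrow> int^'n \<Rightarrow> real" where
  "conductance \<alpha> c x y = c (Upair x y) / lattice_dist x y powr (real CARD('n) + \<alpha>)"

lemma conductance_commute: "conductance \<alpha> c x y = conductance \<alpha> c y x"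
proof -
  have "Upair x y = Upair y x"
    by simp
  then show ?thesis
    by (simp only: conductance_def lattice_dist_commute[of x y])
qed

text \<open>The denominator is \<open>0 powr _ = 0\<close>, and division by zero gives 0 whatever
  the diagonal weight is.\<close>

lemma conductance_self [simp]: "conductance \<alpha> c x x = 0"
  by (simp add: conductance_def)

text \<open>The deterministic half of the argument; the three properties of \<open>c\<close> assumed
  here are those later shown to hold almost surely.\<close>

lemma not_EHI:
  fixes c :: "(int^'n) uprod \<Rightarrow> real"
  assumes \<alpha>: "0 < \<alpha>" "\<alpha> < real CARD('n)"
    and \<kappa>: "0 < \<kappa>" "\<And>x y. x \<noteq> y \<Longrightarrow> \<kappa> \<le> c (Upair x y)"
    and summ: "\<And>x. conductance \<alpha> c x summable_on UNIV"
    and pole: "\<And>n::nat. \<exists>z. z \<notin> lattice_ball x0 (real n) \<and>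
      (\<Sum>x\<in>lattice_ball x0 (real n) - {x0}. conductance \<alpha> c x z) \<le> conductance \<alpha> c x0 z"
  shows "\<not> EHI \<alpha> c x0"
proof
  assume "EHI \<alpha> c x0"
  then obtain R0 c1 where c1: "1 \<le> c1"
    and harnack: "\<And>R f x y. R0 \<le> R \<Longrightarrow> (\<And>x. 0 \<le> f x)
      \<Longrightarrow> vsrw_harmonic_on \<alpha> c f (lattice_ball x0 (2 * R))
      \<Longrightarrow> x \<in> lattice_ball x0 R \<Longrightarrow> y \<in> lattice_ball x0 R \<Longrightarrow> f x \<le> c1 * f y"
    by (rule EHI_D) blast
  define d where "d = CARD('n)"
  define s where "s = real d + \<alpha>"
  define a where "a = conductance \<alpha> c"
  define W where "W = infsum (a x0) UNIV"
  have d: "1 \<le> d"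
    by (simp add: d_def Suc_leI)
  have s: "0 < s"
    using \<alpha> by (simp add: s_def)
  have a_nonneg: "0 \<le> a x y" for x y
    using \<kappa>(1) \<kappa>(2)[of x y] by (cases "x = y") (auto simp: a_def conductance_def)
  have a_commute: "a x y = a y x" for x y
    unfolding a_def by (rule conductance_commute)
  have a_summ: "a x summable_on UNIV" for x
    unfolding a_def by (rule summ)
  have a_pos: "0 < a x y" if "x \<noteq> y" for x y
    using \<kappa>(1) \<kappa>(2)[OF that] one_le_lattice_dist[OF that]
    unfolding a_def conductance_def by (intro divide_pos_pos) auto
  \<comment> \<open>Chosen so that \<open>C * n powr - s\<close> equals
    \<open>\<kappa> * (3 * d\<^sup>2 * n) powr - s\<close>, a lower bound for conductances between
    the two boxes.\<close>
  define C where "C = \<kappa> * (3 * real d ^ 2) powr - s"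
  have C: "0 < C"
    using \<kappa>(1) d by (simp add: C_def)
  \<comment> \<open>The contradiction needs \<open>n powr (d - \<alpha>)\<close> strictly above
    \<open>2 * W * c1 / C\<close>, hence the \<open>+ 1\<close>. The maximum keeps \<open>K\<close>
    positive, so that taking the root with exponent \<open>1 / (d - \<alpha>)\<close> can be
    undone.\<close>
  define K where "K = max 1 (2 * W * c1 / C + 1)"
  obtain n :: nat where n_ge: "max 1 (max R0 (K powr (1 / (real d - \<alpha>)))) \<le> real n"
    using real_arch_simple by blast
  have "K = (K powr (1 / (real d - \<alpha>))) powr (real d - \<alpha>)"
    using \<alpha> by (simp add: powr_powr K_def d_def)
  also have "\<dots> \<le> real n powr (real d - \<alpha>)"
    using n_ge \<alpha> by (intro powr_mono2) (auto simp: d_def)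
  finally have n: "real n powr (real d - \<alpha>) > 2 * W * c1 / C" "1 \<le> n" "R0 \<le> real n"
    using n_ge by (auto simp: K_def)
  \<comment> \<open>\<open>2 * R\<close> is then a natural number, as \<open>pole\<close> requires,
    and \<open>R\<close> is the radius containing the box \<open>X\<close>.\<close>
  define R where "R = real (d * n)"
  define B where "B = lattice_ball x0 (2 * R)"
  have "R0 \<le> real n"
    by (fact n(3))
  also have "\<dots> \<le> R"
    using d unfolding R_def of_nat_le_iff by simp
  finally have R: "R0 \<le> R" .
  have R_nonneg: "0 \<le> R"
    by (simp add: R_def)
  have x0_R: "x0 \<in> lattice_ball x0 R" and x0: "x0 \<in> B"
    using R_nonneg by (auto simp: B_def lattice_ball_def)
  have finB: "finite B"
    by (simp add: B_def finite_lattice_ball)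
  obtain z where z: "z \<notin> B" and z_le: "(\<Sum>x\<in>B - {x0}. a x z) \<le> a x0 z"
    using pole[of "2 * (d * n)"] unfolding B_def R_def a_def of_nat_mult by auto
  have a_z: "0 < a x z" if "x \<in> B" for x
    using that z by (intro a_pos) auto
  obtain f where f_nonneg: "\<And>x. 0 \<le> f x"
    and harmonic: "\<And>x. x \<in> B \<Longrightarrow> ((\<lambda>y. (f y - f x) * a x y) has_sum 0) UNIV"
    and f_x0: "\<And>x. x \<in> B \<Longrightarrow> a x z \<le> infsum (a x) UNIV * f x"
    and flow: "\<And>Y. finite Y \<Longrightarrow> Y \<inter> B = {} \<Longrightarrow>
      (\<Sum>x\<in>B. f x * (\<Sum>y\<in>Y. a x y)) \<le> (\<Sum>x\<in>B. a x z)"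
    by (rule ex_poisson_kernel[of B z a, OF finB z a_commute a_nonneg a_summ a_z], assumption) (rule that; assumption)
  have "vsrw_harmonic_on \<alpha> c f B"
    unfolding vsrw_harmonic_on_def vsrw_generator_def vsrw_term_def
    using harmonic by (auto simp: a_def conductance_def dest: has_sum_imp_summable infsumI)
  then have f_le: "f x0 \<le> c1 * f x" if "x \<in> lattice_ball x0 R" for x
    using harnack[OF R, of f x0 x] f_nonneg x0_R that by (simp add: B_def)
  obtain X Y where XY: "finite X" "finite Y" "X \<subseteq> lattice_ball x0 R" "Y \<inter> B = {}"
    and card: "n ^ d \<le> card X" "n ^ d \<le> card Y"
    and dist: "\<And>x y. x \<in> X \<Longrightarrow> y \<in> Y \<Longrightarrow> lattice_dist x y \<le> real (3 * d\<^sup>2 * n)"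
    using ex_separated_boxes[of x0 n] unfolding d_def R_def B_def by blast
  have XB: "X \<subseteq> B"
    using XY(3) R_nonneg by (auto simp: B_def lattice_ball_def)
  have a_ge: "C * real n powr - s \<le> a x y" if "x \<in> X" "y \<in> Y" for x y
  proof -
    have "x \<noteq> y"
      using that XB XY(4) by auto
    note xy = \<kappa>(2)[OF this] one_le_lattice_dist[OF this]
    have "C * real n powr - s = \<kappa> * real (3 * d\<^sup>2 * n) powr - s"
      by (simp add: C_def powr_mult)
    also have "\<dots> \<le> c (Upair x y) * lattice_dist x y powr - s"
      using xy \<kappa>(1) s dist[OF that] by (intro mult_mono powr_mono2') auto
    also have "\<dots> = a x y"
      by (simp only: a_def conductance_def s_def d_def powr_minus divide_inverse)
    finally show ?thesis .
  qed
  \<comment> \<open>The powers of \<open>n\<close> combine as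
    \<open>2 * d - s = d - \<alpha>\<close>. Harnack replaces \<open>f x0\<close> by
    \<open>c1 * f x\<close> on \<open>X\<close>; enlarging \<open>X\<close> to \<open>B\<close>
    makes the flow bound applicable, and the choice of \<open>z\<close> together with harmonicity at
    \<open>x0\<close> leads back to \<open>f x0\<close>.\<close>
  have "f x0 * (C * real n powr (real d - \<alpha>))
      = real (n ^ d) * (f x0 * (real (n ^ d) * (C * real n powr - s)))"
    using n(2) by (simp add: s_def powr_realpow[symmetric] powr_diff powr_minus powr_add field_simps)
  also have "\<dots> \<le> real (card X) * (f x0 * (real (card Y) * (C * real n powr - s)))"
    using card C f_nonneg by (intro mult_mono) (auto intro!: mult_nonneg_nonneg simp flip: of_nat_power)
  also have "\<dots> = (\<Sum>x\<in>X. f x0 * (\<Sum>y\<in>Y. C * real n powr - s))"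
    by simp
  also have "\<dots> \<le> (\<Sum>x\<in>X. (c1 * f x) * (\<Sum>y\<in>Y. a x y))"
    using XY(3) f_le a_ge f_nonneg c1 C by (intro sum_mono mult_mono) (auto intro!: sum_nonneg)
  also have "\<dots> \<le> (\<Sum>x\<in>B. (c1 * f x) * (\<Sum>y\<in>Y. a x y))"
    using XB finB f_nonneg c1 a_nonneg by (intro sum_mono2) (auto intro!: mult_nonneg_nonneg sum_nonneg)
  also have "\<dots> = c1 * (\<Sum>x\<in>B. f x * (\<Sum>y\<in>Y. a x y))"
    by (simp add: sum_distrib_left mult.assoc)
  also have "\<dots> \<le> c1 * (\<Sum>x\<in>B. a x z)"
    using c1 flow XY by (intro mult_left_mono) auto
  also have "\<dots> \<le> c1 * (2 * a x0 z)"
    using c1 z_le x0 finB by (intro mult_left_mono) (auto simp: sum.remove)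
  also have "\<dots> \<le> c1 * (2 * (W * f x0))"
    using c1 f_x0[OF x0] by (intro mult_left_mono) (auto simp: W_def)
  finally have "f x0 * (C * real n powr (real d - \<alpha>)) \<le> f x0 * (2 * W * c1)"
    by (simp add: algebra_simps)
  \<comment> \<open>Positivity comes from the strictly positive conductance between
    \<open>x0\<close> and \<open>z\<close>, and allows \<open>f x0\<close> to be cancelled.\<close>
  moreover have "0 < f x0"
  proof -
    have "0 < infsum (a x0) UNIV * f x0"
      using f_x0[OF x0] a_z[OF x0] by linarith
    then show ?thesis
      using f_nonneg[of x0] by (cases "f x0 = 0") auto
  qed
  ultimately have "C * real n powr (real d - \<alpha>) \<le> 2 * W * c1"
    by simp
  then show False
    using n(1) C by (simp add: field_simps)
qed

subsection \<open>Almost sure properties of the environment\<close>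

text \<open>A Borel-Cantelli argument: each block has at most \<open>N\<close> independent
  coordinates, so its event has probability at least a fixed \<open>\<epsilon> > 0\<close>. Disjoint
  blocks are independent, so the first \<open>m + 1\<close> of a sequence of blocks all fail with
  probability at most \<open>(1 - \<epsilon>) ^ (m + 1)\<close>.\<close>

lemma (in prob_space) AE_ex_block_event:
  fixes X :: "'i \<Rightarrow> 'a \<Rightarrow> real" and K :: "'j \<Rightarrow> 'i set"
  assumes indep: "indep_vars (\<lambda>_. borel) X UNIV"
    and disj: "disjoint_family_on K L" and inf: "infinite L"
    and fin: "\<And>j. j \<in> L \<Longrightarrow> finite (K j)" "\<And>j. j \<in> L \<Longrightarrow> card (K j) \<le> N"
    and A: "\<And>j e. A j e \<in> sets borel"
    and \<delta>: "0 < \<delta>" "\<And>j e. j \<in> L \<Longrightarrow> e \<in> K j \<Longrightarrow> \<delta> \<le> prob (X e -` A j e \<inter> space M)"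
  shows "AE \<omega> in M. \<exists>j\<in>L. \<forall>e\<in>K j. X e \<omega> \<in> A j e"
proof -
  \<comment> \<open>A base of at most 1 makes the power decrease with the exponent, so
    \<open>N\<close> can replace the actual block size.\<close>
  define \<epsilon> where "\<epsilon> = min 1 \<delta> ^ N"
  have \<epsilon>: "0 < \<epsilon>" "\<epsilon> \<le> 1"
    using \<delta>(1) by (auto simp: \<epsilon>_def power_le_one)
  \<comment> \<open>Bundling the coordinates of a block turns independence of \<open>X\<close> into
    independence of the blocks.\<close>
  define Z where "Z j \<omega> = restrict (\<lambda>e. X e \<omega>) (K j)" for j \<omega>
  have indepZ: "indep_vars (\<lambda>j. PiM (K j) (\<lambda>_. borel)) Z L"
    using indep_vars_restrict[OF indep, of L K] disj by (simp add: Z_def[abs_def])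
  define G where "G j = PiE (K j) (A j)" for j
  have G: "G j \<in> sets (PiM (K j) (\<lambda>_. borel))" if "j \<in> L" for j
    unfolding G_def using fin that A by (intro sets_PiM_I_finite) auto
  define E where "E j = (\<Inter>e\<in>K j. X e -` A j e) \<inter> space M" for j
  have Z_E: "Z j -` G j \<inter> space M = E j" for j
    by (auto simp: Z_def G_def E_def PiE_iff)
  have E_sets: "E j \<in> events" if "j \<in> L" for j
    unfolding Z_E[symmetric] using indepZ that G[OF that] by (auto simp: indep_vars_def intro!: measurable_sets)
  have prob_E: "\<epsilon> \<le> prob (E j)" if j: "j \<in> L" for j
  \<comment> \<open>The product formula for independent variables needs a nonempty index set; for an
    empty block the event is the whole space.\<close>
  proof (cases "K j = {}")
    case True
    then show ?thesis
      using \<epsilon> by (simp add: E_def prob_space)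
  next
    case False
    have "\<epsilon> \<le> min 1 \<delta> ^ card (K j)"
      unfolding \<epsilon>_def using \<delta>(1) fin(2)[OF j] by (intro power_decreasing) auto
    also have "\<dots> = (\<Prod>e\<in>K j. min 1 \<delta>)"
      by simp
    also have "\<dots> \<le> (\<Prod>e\<in>K j. prob (X e -` A j e \<inter> space M))"
      using \<delta> j by (intro prod_mono) (auto intro: min.coboundedI2)
    also have "\<dots> = prob (\<Inter>e\<in>K j. X e -` A j e \<inter> space M)"
      using indep_varsD[OF indep False fin(1)[OF j], of "A j"] A by simp
    also have "(\<Inter>e\<in>K j. X e -` A j e \<inter> space M) = E j"
      using False by (auto simp: E_def)
    finally show ?thesis .
  qed
  obtain u :: "nat \<Rightarrow> 'j" where u: "inj u" "range u \<subseteq> L"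
    using infinite_countable_subset[OF inf] by blast
  define D where "D m = (\<Inter>j\<in>u ` {..m}. space M - E j)" for m
  have D_sets: "D m \<in> events" for m
    unfolding D_def using E_sets u(2) by (intro sets.finite_INT sets.compl_sets) auto
  have D_le: "prob (D m) \<le> (1 - \<epsilon>) ^ m" for m
  proof -
    \<comment> \<open>Writing the failure of a block as a preimage under \<open>Z j\<close> lets
      independence apply to the complements directly.\<close>
    have compl: "Z j -` (space (PiM (K j) (\<lambda>_. borel)) - G j) \<inter> space M = space M - E j" for j
      unfolding Z_E[symmetric] by (auto simp: Z_def space_PiM)
    have "prob (D m) = prob (\<Inter>j\<in>u ` {..m}. Z j -` (space (PiM (K j) (\<lambda>_. borel)) - G j) \<inter> space M)"
      by (simp only: D_def compl)
    also have "\<dots> = (\<Prod>j\<in>u ` {..m}. prob (Z j -` (space (PiM (K j) (\<lambda>_. borel)) - G j) \<inter> space M))"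
      using u G by (intro indep_varsD[OF indepZ]) (auto intro!: sets.compl_sets)
    also have "\<dots> = (\<Prod>j\<in>u ` {..m}. 1 - prob (E j))"
      unfolding compl using E_sets u by (intro prod.cong refl prob_compl) auto
    also have "\<dots> \<le> (\<Prod>j\<in>u ` {..m}. 1 - \<epsilon>)"
      using prob_E u by (intro prod_mono) (auto simp: prob_le_1)
    also have "\<dots> = (1 - \<epsilon>) ^ Suc m"
      using u by (simp add: card_image inj_on_subset)
    also have "\<dots> \<le> (1 - \<epsilon>) ^ m"
      using \<epsilon> by (intro power_decreasing) auto
    finally show ?thesis .
  qed
  have "(\<lambda>m. (1 - \<epsilon>) ^ m) \<longlonglongrightarrow> 0"
    using \<epsilon> by (intro LIMSEQ_realpow_zero) auto
  moreover have "prob (\<Inter>m. D m) \<le> (1 - \<epsilon>) ^ m" for m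
    using D_sets by (intro order_trans[OF finite_measure_mono D_le]) auto
  ultimately have "prob (\<Inter>m. D m) \<le> 0"
    by (intro LIMSEQ_le_const) blast+
  then have "emeasure M (\<Inter>m. D m) = 0"
    by (simp add: emeasure_eq_measure measure_le_0_iff)
  moreover have "{\<omega> \<in> space M. \<not> (\<exists>j\<in>L. \<forall>e\<in>K j. X e \<omega> \<in> A j e)} \<subseteq> (\<Inter>m. D m)"
    using u by (auto simp: D_def E_def)
  moreover have "(\<Inter>m. D m) \<in> events"
    using D_sets by auto
  ultimately show ?thesis
    by (intro AE_I)
qed

text \<open>By Tonelli the mean of the sum is at most \<open>C\<close> times the sum of
  \<open>b\<close>, hence finite, so the sum itself is finite almost surely.\<close>

lemma AE_summable_on_of_bounded_means:
  fixes X :: "'i \<Rightarrow> 'a \<Rightarrow> real"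
  assumes I: "countable I" and meas: "\<And>i. i \<in> I \<Longrightarrow> X i \<in> borel_measurable M"
    and nonneg: "\<And>i \<omega>. i \<in> I \<Longrightarrow> \<omega> \<in> space M \<Longrightarrow> 0 \<le> X i \<omega>"
    and b: "b summable_on I" "\<And>i. i \<in> I \<Longrightarrow> 0 \<le> b i"
    and C: "C < \<infinity>" "\<And>i. i \<in> I \<Longrightarrow> (\<integral>\<^sup>+\<omega>. ennreal (X i \<omega>) \<partial>M) \<le> C * ennreal (b i)"
  shows "AE \<omega> in M. (\<lambda>i. X i \<omega>) summable_on I"
proof -
  have "(\<integral>\<^sup>+i. ennreal (b i) \<partial>count_space I) < \<infinity>"
  proof -
    have "Infinite_Set_Sum.abs_summable_on b I"
      using b(1) by (simp only: abs_summable_equivalent[symmetric] summable_on_iff_abs_summable_on_real[symmetric])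
    then have "(\<integral>\<^sup>+i. ennreal (norm (b i)) \<partial>count_space I) < \<infinity>"
      by (simp add: Infinite_Set_Sum.abs_summable_on_def integrable_iff_bounded)
    also have "(\<integral>\<^sup>+i. ennreal (norm (b i)) \<partial>count_space I) = (\<integral>\<^sup>+i. ennreal (b i) \<partial>count_space I)"
      using b(2) by (intro nn_integral_cong) simp
    finally show ?thesis .
  qed
  then have fin: "(\<integral>\<^sup>+i. C * ennreal (b i) \<partial>count_space I) < \<infinity>"
    using C(1) by (simp add: nn_integral_cmult ennreal_mult_less_top)
  have meas_sum: "(\<lambda>\<omega>. \<integral>\<^sup>+i. ennreal (X i \<omega>) \<partial>count_space I) \<in> borel_measurable M"
  proof (intro sigma_finite_measure.borel_measurable_nn_integral
      sigma_finite_measure_count_space_countable I)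
    \<comment> \<open>Joint measurability, required for the sum to be a random variable, follows
      from countability of \<open>I\<close>.\<close>
    have "(\<lambda>p. ennreal (X (snd p) (fst p))) \<in> borel_measurable (M \<Otimes>\<^sub>M count_space I)"
    proof (rule measurable_compose_countable'[OF _ measurable_snd I])
      show "(\<lambda>p. ennreal (X i (fst p))) \<in> borel_measurable (M \<Otimes>\<^sub>M count_space I)" if "i \<in> I" for i
        using meas[OF that] by (intro measurable_compose[OF measurable_fst]) auto
    qed
    then show "(\<lambda>(\<omega>, i). ennreal (X i \<omega>)) \<in> borel_measurable (M \<Otimes>\<^sub>M count_space I)"
      by (simp add: case_prod_beta')
  qed
  have "(\<integral>\<^sup>+\<omega>. \<integral>\<^sup>+i. ennreal (X i \<omega>) \<partial>count_space I \<partial>M)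
      = (\<integral>\<^sup>+i. \<integral>\<^sup>+\<omega>. ennreal (X i \<omega>) \<partial>M \<partial>count_space I)"
    using I meas by (intro nn_integral_count_space_nn_integral) auto
  also have "\<dots> \<le> (\<integral>\<^sup>+i. C * ennreal (b i) \<partial>count_space I)"
    using C(2) by (intro nn_integral_mono) simp
  also note fin
  finally have "(\<integral>\<^sup>+\<omega>. \<integral>\<^sup>+i. ennreal (X i \<omega>) \<partial>count_space I \<partial>M) \<noteq> \<infinity>"
    by simp
  from nn_integral_PInf_AE[OF meas_sum this]
  have "AE \<omega> in M. (\<integral>\<^sup>+i. ennreal (X i \<omega>) \<partial>count_space I) \<noteq> \<infinity>" .
  then show ?thesis
  proof (rule AE_mp[OF _ AE_I2], intro impI)
    fix \<omega> assume \<omega>: "\<omega> \<in> space M" and "(\<integral>\<^sup>+i. ennreal (X i \<omega>) \<partial>count_space I) \<noteq> \<infinity>"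
    moreover have "(\<integral>\<^sup>+i. ennreal (X i \<omega>) \<partial>count_space I)
        = (\<integral>\<^sup>+i. ennreal (norm (X i \<omega>)) \<partial>count_space I)"
      using nonneg \<omega> by (intro nn_integral_cong) simp
    ultimately have "Infinite_Set_Sum.abs_summable_on (\<lambda>i. X i \<omega>) I"
      by (simp add: Infinite_Set_Sum.abs_summable_on_def integrable_iff_bounded top.not_eq_extremum)
    then show "(\<lambda>i. X i \<omega>) summable_on I"
      by (simp only: abs_summable_equivalent[symmetric] abs_summable_summable)
  qed
qed

text \<open>As \<open>z\<close> is outside the doubled ball, each \<open>x\<close> in the ball is at
  least half as far from \<open>z\<close> as \<open>x0\<close> is. This costs a factor
  \<open>2 powr (d + \<alpha>)\<close> per point, which \<open>ge\<close> compensates for all points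
  at once.\<close>

lemma sum_conductance_le_pole:
  fixes c :: "(int^'n) uprod \<Rightarrow> real"
  assumes "0 \<le> r" "0 < c0" "0 < \<alpha>" and z: "z \<notin> lattice_ball x0 (2 * r)"
    and le: "\<And>x. x \<in> lattice_ball x0 r \<Longrightarrow> x \<noteq> x0 \<Longrightarrow> c (Upair x z) \<le> c0"
    and ge: "c0 * 2 powr (real CARD('n) + \<alpha>) * card (lattice_ball x0 r) \<le> c (Upair x0 z)"
  shows "(\<Sum>x\<in>lattice_ball x0 r - {x0}. conductance \<alpha> c x z) \<le> conductance \<alpha> c x0 z"
proof -
  define s where "s = real CARD('n) + \<alpha>"
  define D where "D = lattice_dist x0 z"
  have D: "2 * r < D"
    using z by (simp add: D_def lattice_ball_def)
  have s: "0 < s"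
    using assms(3) by (simp add: s_def add_nonneg_pos)
  have "(\<Sum>x\<in>lattice_ball x0 r - {x0}. conductance \<alpha> c x z)
      \<le> (\<Sum>x\<in>lattice_ball x0 r - {x0}. c0 * 2 powr s * D powr - s)"
  proof (rule sum_mono)
    fix x assume x: "x \<in> lattice_ball x0 r - {x0}"
    have dist: "D / 2 \<le> lattice_dist x z"
      using x D lattice_dist_triangle[of x0 z x] by (simp add: lattice_ball_def D_def)
    have "conductance \<alpha> c x z = c (Upair x z) * lattice_dist x z powr - s"
      by (simp only: conductance_def s_def powr_minus divide_inverse)
    also have "\<dots> \<le> c0 * (D / 2) powr - s"
      using le[of x] x dist D s assms(1,2) by (intro mult_mono powr_mono2') auto
    also have "(D / 2) powr - s = 2 powr s * D powr - s"
      using D assms(1) by (simp add: powr_divide powr_minus field_simps)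
    finally show "conductance \<alpha> c x z \<le> c0 * 2 powr s * D powr - s"
      by simp
  qed
  also have "\<dots> \<le> card (lattice_ball x0 r) * (c0 * 2 powr s * D powr - s)"
    using assms(2) finite_lattice_ball[of x0 r] unfolding sum_constant
    by (intro mult_right_mono of_nat_mono card_mono) auto
  also have "\<dots> = c0 * 2 powr s * card (lattice_ball x0 r) * D powr - s"
    by simp
  also have "\<dots> \<le> c (Upair x0 z) * D powr - s"
    using ge by (intro mult_right_mono) (auto simp: s_def)
  also have "\<dots> = conductance \<alpha> c x0 z"
    by (simp only: conductance_def s_def D_def powr_minus divide_inverse)
  finally show ?thesis .
qed

text \<open>The blocks are the sets of edges joining a far point \<open>z\<close> to the ball. They
  all have at most as many edges as the ball has points, and they are disjoint for distinct
  \<open>z\<close> because \<open>z\<close> lies outside the ball.\<close>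

lemma (in prob_space) AE_ex_pole:
  fixes w :: "(int^'n) uprod \<Rightarrow> 'a \<Rightarrow> real"
  assumes indep: "indep_vars (\<lambda>_. borel) w UNIV" and "0 \<le> r" "0 < \<alpha>"
    and c0: "0 < c0" "0 < (INF e\<in>{e. proper_uprod e}. prob {\<omega> \<in> space M. w e \<omega> \<le> c0})"
    and big: "\<And>k. 0 < k \<Longrightarrow> 0 < (INF e\<in>{e. proper_uprod e}. prob {\<omega> \<in> space M. k < w e \<omega>})"
  shows "AE \<omega> in M. \<exists>z. z \<notin> lattice_ball x0 r \<and>
    (\<Sum>x\<in>lattice_ball x0 r - {x0}. conductance \<alpha> (\<lambda>e. w e \<omega>) x z) \<le> conductance \<alpha> (\<lambda>e. w e \<omega>) x0 z"
proof -
  define B where "B = lattice_ball x0 r"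
  define L where "L = - lattice_ball x0 (2 * r)"
  define K where "K z = (\<lambda>x. Upair x z) ` B" for z
  define k where "k = c0 * 2 powr (real CARD('n) + \<alpha>) * card B"
  \<comment> \<open>The edge to the centre has to be large and the other edges of the block small;
    \<open>k\<close> is the threshold demanded by \<open>sum_conductance_le_pole\<close>.\<close>
  define A where "A z e = (if e = Upair x0 z then {k<..} else {..c0})" for z e
  define \<delta>1 where "\<delta>1 = (INF e\<in>{e. proper_uprod e}. prob {\<omega> \<in> space M. w e \<omega> \<le> c0})"
  define \<delta>2 where "\<delta>2 = (INF e\<in>{e. proper_uprod e}. prob {\<omega> \<in> space M. k < w e \<omega>})"
  have finB: "finite B" and x0: "x0 \<in> B"
    using assms(2) finite_lattice_ball by (auto simp: B_def lattice_ball_def)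
  then have "0 < card B"
    by (auto simp: card_gt_0_iff)
  then have k: "0 < k"
    using c0(1) by (simp add: k_def)
  have LB: "z \<notin> B" if "z \<in> L" for z
    using that assms(2) by (auto simp: L_def B_def lattice_ball_def)
  have "AE \<omega> in M. \<exists>z\<in>L. \<forall>e\<in>K z. w e \<omega> \<in> A z e"
  proof (rule AE_ex_block_event[OF indep])
    show "disjoint_family_on K L"
      using LB by (auto simp: disjoint_family_on_def K_def)
    show "infinite L"
      unfolding L_def by (rule infinite_Compl_lattice_ball)
    show "finite (K z)" "card (K z) \<le> card B" for z
      using finB by (auto simp: K_def card_image_le)
    show "A z e \<in> sets borel" for z e
      by (simp add: A_def)
    show "0 < min \<delta>1 \<delta>2"
      using c0(2) big[OF k] by (simp add: \<delta>1_def \<delta>2_def)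
    show "min \<delta>1 \<delta>2 \<le> prob (w e -` A z e \<inter> space M)" if z: "z \<in> L" and e: "e \<in> K z" for z e
    proof -
      have proper: "proper_uprod e"
        using e LB[OF z] by (auto simp: K_def)
      \<comment> \<open>The infima are real-valued, so bounding them by a member requires
        boundedness below.\<close>
      have bdd: "bdd_below ((\<lambda>e. prob (S e)) ` T)" for S and T :: "(int^'n) uprod set"
        by (rule bdd_belowI[of _ 0]) auto
      have "\<delta>1 \<le> prob {\<omega> \<in> space M. w e \<omega> \<le> c0}" "\<delta>2 \<le> prob {\<omega> \<in> space M. k < w e \<omega>}"
        unfolding \<delta>1_def \<delta>2_def using proper by (auto intro!: cINF_lower bdd)
      moreover have "w e -` A z e \<inter> space M =
          (if e = Upair x0 z then {\<omega> \<in> space M. k < w e \<omega>} else {\<omega> \<in> space M. w e \<omega> \<le> c0})"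
        by (auto simp: A_def)
      ultimately show ?thesis
        by auto
    qed
  qed
  then show ?thesis
  proof (rule AE_mp[OF _ AE_I2], intro impI)
    fix \<omega> assume "\<exists>z\<in>L. \<forall>e\<in>K z. w e \<omega> \<in> A z e"
    then obtain z where z: "z \<in> L" and K: "\<And>x. x \<in> B \<Longrightarrow> w (Upair x z) \<omega> \<in> A z (Upair x z)"
      by (auto simp: K_def)
    have "w (Upair x z) \<omega> \<le> c0" if "x \<in> B" "x \<noteq> x0" for x
      using K[OF that(1)] that LB[OF z] by (auto simp: A_def split: if_splits)
    moreover have "k \<le> w (Upair x0 z) \<omega>"
      using K[OF x0] by (simp add: A_def)
    ultimately show "\<exists>z. z \<notin> lattice_ball x0 r \<and>
        (\<Sum>x\<in>lattice_ball x0 r - {x0}. conductance \<alpha> (\<lambda>e. w e \<omega>) x z)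
          \<le> conductance \<alpha> (\<lambda>e. w e \<omega>) x0 z"
      using LB[OF z] z assms(2,3) c0(1)
      by (intro exI[of _ z] conjI sum_conductance_le_pole) (auto simp: B_def L_def k_def)
  qed
qed

text \<open>The means are at most \<open>C\<close> times the distance to the power
  \<open>- (d + \<alpha>)\<close>, which is summable because the exponent exceeds the
  dimension.\<close>

lemma AE_conductance_summable_on:
  fixes w :: "(int^'n) uprod \<Rightarrow> 'a \<Rightarrow> real"
  assumes "0 < \<alpha>" and meas: "\<And>e. w e \<in> borel_measurable M"
    and nonneg: "\<And>e \<omega>. \<omega> \<in> space M \<Longrightarrow> 0 \<le> w e \<omega>"
    and C: "C < \<infinity>" "\<And>e. proper_uprod e \<Longrightarrow> (\<integral>\<^sup>+\<omega>. ennreal (w e \<omega>) \<partial>M) \<le> C"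
  shows "AE \<omega> in M. conductance \<alpha> (\<lambda>e. w e \<omega>) x summable_on UNIV"
proof (rule AE_summable_on_of_bounded_means[OF _ _ _ _ _ C(1)])
  let ?b = "\<lambda>y. 1 / lattice_dist x y powr (real CARD('n) + \<alpha>)"
  show "?b summable_on UNIV"
    using assms(1) by (intro summable_on_lattice_dist_powr) simp
  show "0 \<le> ?b y" for y
    by simp
  show "(\<lambda>\<omega>. conductance \<alpha> (\<lambda>e. w e \<omega>) x y) \<in> borel_measurable M" for y
    unfolding conductance_def using meas by measurable
  show "0 \<le> conductance \<alpha> (\<lambda>e. w e \<omega>) x y" if "\<omega> \<in> space M" for y \<omega>
    using nonneg[OF that] by (simp add: conductance_def)
  show "(\<integral>\<^sup>+\<omega>. ennreal (conductance \<alpha> (\<lambda>e. w e \<omega>) x y) \<partial>M) \<le> C * ennreal (?b y)" for y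
  proof (cases "x = y")
    case False
    have "(\<integral>\<^sup>+\<omega>. ennreal (conductance \<alpha> (\<lambda>e. w e \<omega>) x y) \<partial>M)
        = (\<integral>\<^sup>+\<omega>. ennreal (w (Upair x y) \<omega>) * ennreal (?b y) \<partial>M)"
      using nonneg by (intro nn_integral_cong) (simp add: conductance_def flip: ennreal_mult)
    also have "\<dots> = (\<integral>\<^sup>+\<omega>. ennreal (w (Upair x y) \<omega>) \<partial>M) * ennreal (?b y)"
      using meas by (intro nn_integral_multc) measurable
    also have "\<dots> \<le> C * ennreal (?b y)"
      using C(2)[of "Upair x y"] False by (intro mult_right_mono) auto
    finally show ?thesis .
  qed simp
qed simp

text \<open>Pointwise \<open>t \<le> 1 + t ^ m\<close> for \<open>t \<ge> 0\<close>; a bound on a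
  high moment thus gives one on the mean.\<close>

lemma (in prob_space) nn_integral_le_one_plus_power:
  assumes "m \<ge> 1" and meas: "X \<in> borel_measurable M"
    and nonneg: "\<And>\<omega>. \<omega> \<in> space M \<Longrightarrow> 0 \<le> X \<omega>"
  shows "(\<integral>\<^sup>+\<omega>. ennreal (X \<omega>) \<partial>M) \<le> 1 + (\<integral>\<^sup>+\<omega>. ennreal (X \<omega> ^ m) \<partial>M)"
proof -
  have "(\<integral>\<^sup>+\<omega>. ennreal (X \<omega>) \<partial>M) \<le> (\<integral>\<^sup>+\<omega>. 1 + ennreal (X \<omega> ^ m) \<partial>M)"
  proof (rule nn_integral_mono)
    fix \<omega> assume \<omega>: "\<omega> \<in> space M"
    have "X \<omega> \<le> 1 + X \<omega> ^ m"
    proof (cases "X \<omega> \<le> 1")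
      case True
      then show ?thesis
        using nonneg[OF \<omega>] by (simp add: add_increasing2)
    next
      case False
      then show ?thesis
        using assms(1) power_increasing[of 1 m "X \<omega>"] by simp
    qed
    then have "ennreal (X \<omega>) \<le> ennreal (1 + X \<omega> ^ m)"
      by (rule ennreal_leI)
    then show "ennreal (X \<omega>) \<le> 1 + ennreal (X \<omega> ^ m)"
      using nonneg[OF \<omega>] by (simp add: ennreal_plus)
  qed
  also have "\<dots> = 1 + (\<integral>\<^sup>+\<omega>. ennreal (X \<omega> ^ m) \<partial>M)"
    using meas by (subst nn_integral_add) (auto simp: emeasure_space_1)
  finally show ?thesis .
qed

text \<open>In \<open>ennreal\<close> the inverse of 0 is infinite, so a finite supremum also
  excludes zero weights. The witness uses \<open>m + 1\<close> because \<open>m\<close> is 0 when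
  \<open>S\<close> is empty.\<close>

lemma ex_pos_lower_bound_of_SUP_inverse:
  fixes f :: "'b \<Rightarrow> real"
  assumes "(SUP e\<in>S. inverse (ennreal (f e))) < \<infinity>" and nonneg: "\<And>e. e \<in> S \<Longrightarrow> 0 \<le> f e"
  shows "\<exists>\<kappa>>0. \<forall>e\<in>S. \<kappa> \<le> f e"
proof -
  obtain m where m: "0 \<le> m" "(SUP e\<in>S. inverse (ennreal (f e))) = ennreal m"
    using assms(1) by (cases "SUP e\<in>S. inverse (ennreal (f e))") auto
  have "1 / (m + 1) \<le> f e" if e: "e \<in> S" for e
  proof -
    have le: "inverse (ennreal (f e)) \<le> ennreal m"
      unfolding m(2)[symmetric] using e by (rule SUP_upper)
    then have "f e \<noteq> 0"
      by (auto simp: top_unique)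
    then have "0 < f e"
      using nonneg[OF e] by simp
    then have "inverse (f e) \<le> m"
      using le m(1) by (simp add: inverse_ennreal)
    then show ?thesis
      using \<open>0 < f e\<close> m(1) by (simp add: field_simps)
  qed
  then show ?thesis
    using m(1) by (intro exI[of _ "1 / (m + 1)"]) auto
qed


section \<open>Almost sure failure of the elliptic Harnack inequality\<close>

theorem proposition4p7:
  fixes M :: "'a measure"
    and w :: "(int^'n) uprod \<Rightarrow> 'a \<Rightarrow> real"
    and \<alpha> \<theta>0 :: real and p q :: nat
  assumes "prob_space M"
    and "0 < \<alpha>" and "\<alpha> < 2"
    and "real CARD('n) > 4 - 2 * \<alpha>" and "real CARD('n) > \<alpha>"
    and "prob_space.indep_vars M (\<lambda>_. borel) w UNIV"
    and "\<And>x y \<omega>. x \<noteq> y \<Longrightarrow> \<omega> \<in> space M \<Longrightarrow> w (Upair x y) \<omega> \<ge> 0"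
    and "\<And>x \<omega>. \<omega> \<in> space M \<Longrightarrow> w (Upair x x) \<omega> = 0"
    and "(SUP e\<in>{e. proper_uprod e}. measure M {\<omega> \<in> space M. w e \<omega> = 0}) < 1 / 2 ^ 4"
    and "\<theta>0 = \<alpha> / (2 * real CARD('n) + \<alpha>)"
    and "real p > max ((real CARD('n) + 1 + \<theta>0) / (real CARD('n) * \<theta>0))
                      ((real CARD('n) + 1) / (2 * \<theta>0 * (2 - \<alpha>)))"
    and "real q > (real CARD('n) + 1 + \<theta>0) / (real CARD('n) * \<theta>0)"
    and "(SUP e\<in>{e. proper_uprod e}. \<integral>\<^sup>+\<omega>. ennreal (w e \<omega> ^ (2 * p)) \<partial>M) < \<infinity>"
    and "(SUP e\<in>{e. proper_uprod e}.
            \<integral>\<^sup>+\<omega>. ennreal (1 / w e \<omega> ^ (2 * q)) * indicator {\<omega>. w e \<omega> \<noteq> 0} \<omega> \<partial>M) < \<infinity>"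
    and "AE \<omega> in M. (SUP e\<in>{e. proper_uprod e}. inverse (ennreal (w e \<omega>))) < \<infinity>"
    and "\<exists>c0>0. (INF e\<in>{e. proper_uprod e}. measure M {\<omega> \<in> space M. w e \<omega> \<le> c0}) > 0"
    and "\<forall>k>0. (INF e\<in>{e. proper_uprod e}. measure M {\<omega> \<in> space M. w e \<omega> > k}) > 0"
  shows "AE \<omega> in M. \<forall>x0. \<not> EHI \<alpha> (\<lambda>e. w e \<omega>) x0"
proof -
  interpret prob_space M
    by fact
  note indep = assms(6)
  have meas: "w e \<in> borel_measurable M" for e
    using indep by (auto simp: indep_vars_def)
  have nonneg: "0 \<le> w e \<omega>" if "\<omega> \<in> space M" for e \<omega>
  proof (cases e)
    case (Upair x y)
    then show ?thesis
      using assms(7)[of x y \<omega>] assms(8)[of \<omega> x] that by (cases "x = y") auto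
  qed
  have "0 \<le> \<theta>0"
    using assms(2,10) by simp
  \<comment> \<open>Nonnegativity of the threshold forces \<open>p > 0\<close>, so the moment of
    order \<open>2 * p\<close> controls the mean.\<close>
  then have "0 \<le> (real CARD('n) + 1 + \<theta>0) / (real CARD('n) * \<theta>0)"
    by simp
  then have p: "1 \<le> 2 * p"
    using assms(11) by linarith
  define C where "C = 1 + (SUP e\<in>{e. proper_uprod e}. \<integral>\<^sup>+\<omega>. ennreal (w e \<omega> ^ (2 * p)) \<partial>M)"
  have C: "C < \<infinity>"
    using assms(13) by (simp add: C_def)
  have mean_le: "(\<integral>\<^sup>+\<omega>. ennreal (w e \<omega>) \<partial>M) \<le> C" if "proper_uprod e" for e
  proof -
    have "(\<integral>\<^sup>+\<omega>. ennreal (w e \<omega>) \<partial>M) \<le> 1 + (\<integral>\<^sup>+\<omega>. ennreal (w e \<omega> ^ (2 * p)) \<partial>M)"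
      using p meas nonneg by (rule nn_integral_le_one_plus_power)
    also have "\<dots> \<le> C"
      unfolding C_def using that by (intro add_left_mono SUP_upper) simp
    finally show ?thesis .
  qed
  \<comment> \<open>The lattice is countable, so one null set serves all \<open>x\<close>; likewise
    below for all centres and natural radii.\<close>
  have summ: "AE \<omega> in M. \<forall>x. conductance \<alpha> (\<lambda>e. w e \<omega>) x summable_on UNIV"
    unfolding AE_all_countable
    using AE_conductance_summable_on[of \<alpha> w M C] assms(2) meas nonneg C mean_le by blast
  obtain c0 where c0: "0 < c0" "0 < (INF e\<in>{e. proper_uprod e}. prob {\<omega> \<in> space M. w e \<omega> \<le> c0})"
    using assms(16) by blast
  have pole: "AE \<omega> in M. \<forall>x0. \<forall>n::nat. \<exists>z. z \<notin> lattice_ball x0 (real n) \<and>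
      (\<Sum>x\<in>lattice_ball x0 (real n) - {x0}. conductance \<alpha> (\<lambda>e. w e \<omega>) x z)
        \<le> conductance \<alpha> (\<lambda>e. w e \<omega>) x0 z"
    unfolding AE_all_countable using assms(2,17) c0
    by (intro allI AE_ex_pole[OF indep]) auto
  show ?thesis
    using summ pole assms(15) AE_space
  proof eventually_elim
    case (elim \<omega>)
    obtain \<kappa> where \<kappa>: "0 < \<kappa>" "\<And>e. proper_uprod e \<Longrightarrow> \<kappa> \<le> w e \<omega>"
      using ex_pos_lower_bound_of_SUP_inverse[OF elim(3)] nonneg[OF elim(4)] by auto
    then show ?case
      using assms(2,5) elim(1,2) by (intro allI not_EHI[of \<alpha> \<kappa>]) auto
  qed
qed

end
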